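(* Let $s>0$, let $h:\mathbb{R}^n\to[0,\infty)$ be a proper log-concave function and suppose that $\hslash_{B^{n+1}}^s$ is its John $s$-function. Let $\nu$ be any finite positive, non-zero measure on $B^n$ with support inside the set $\Lambda=\{x\in B^n: h(x)^{1/s}=\hslash_{B^{n+1}}(x)\}$, and let $F\in\mathcal{W}$ be any $C^1$ function. Consider the convex functional $\bar I_\nu:\mathcal{E}\to\mathbb{R}$ defined by $$\bar I_\nu(M\oplus\beta,w)=\int_{B^n}h(x)^{1/s}F\left(\frac{\langle x,Mx+w\rangle}{h(x)^{2/s}}+\beta\right)d\nu(x).$$ If the restriction of $\bar I_\nu$ to ${}^{(s)}\mathrm{Sym}_{n+1,0}(\mathbb{R})\times\mathbb{R}^n$ is coercive, then for any global minimum $(M_0\oplus\beta_0,w_0)$ of this restriction, the measure $$\frac{1}{h(x)^{1/s}}F'\left(\frac{\langle x,M_0x+w_0\rangle}{h(x)^{2/s}}+\beta_0\right)d\nu(x)$$ is non-negative, non-zero, centered, and $s$-isotropic.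
   Context: Notation: $|\cdot|_2$ is the Euclidean norm, $\langle\cdot,\cdot\rangle$ the standard inner product, $B^d$ the closed unit Euclidean ball of $\mathbb{R}^d$, $v\otimes w=vw^T$. For an $n\times n$ matrix $A$ and $\alpha\in\mathbb{R}$, $A\oplus\alpha$ is the $(n+1)\times(n+1)$ block diagonal matrix with blocks $A$ and $\alpha$. A function $h:\mathbb{R}^n\to[0,\infty)$ is log-concave if $h=e^{-\varphi}$ with $\varphi:\mathbb{R}^n\to(-\infty,+\infty]$ convex; it is proper if moreover it is upper semicontinuous and has finite positive integral. John $s$-function: the $s$-lifting of $h$ is ${}^{(s)}\bar h=\{(x,\xi)\in\mathbb{R}^{n}\times\mathbb{R}:|\xi|\le h(x)^{1/s}\}$. An $n$-symmetric ellipsoid in $\mathbb{R}^{n+1}$ is a set $(A\oplus\alpha)B^{n+1}+(a,0)$ with $A$ symmetric positive definite $n\times n$, $\alpha>0$, $a\in\mathbb{R}^n$. The $s$-volume of a Borel set $\bar C\subset\mathbb{R}^{n+1}$ symmetric under $(x,t)\mapsto(x,-t)$ is $\int_{\mathbb{R}^n}[\frac12 \ell(\bar C\cap l_x)]^s dx$, where $l_x$ is the line $\{x\}\times\mathbb{R}$ and $\ell$ is one-dimensional Lebesgue measure; the $s$-volume of $(A\oplus\alpha)B^{n+1}+(a,0)$ is $\alpha^s\det(A)$ times that of $B^{n+1}$. For a proper log-concave $h$ there is a unique $n$-symmetric ellipsoid of maximal $s$-volume contained in ${}^{(s)}\bar h$, the John $s$-ellipsoid $\bar E$ of $h$; the function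 $x\mapsto[\frac12\ell(\bar E\cap l_x)]^s$ is the John $s$-function of $h$. With $\hslash_{B^{n+1}}(x)=\sqrt{1-|x|_2^2}$ for $x\in B^n$ and $0$ otherwise, "$\hslash_{B^{n+1}}^s$ is the John $s$-function of $h$" means that $B^{n+1}$ is the John $s$-ellipsoid of $h$. $\mathcal{E}=\{(A\oplus\alpha,a): A \text{ a symmetric } n\times n \text{ matrix},\ \alpha\in\mathbb{R},\ a\in\mathbb{R}^n\}$. The $s$-trace is ${}^{(s)}\mathrm{tr}(M\oplus\beta)=s\beta+\mathrm{tr}(M)$, and ${}^{(s)}\mathrm{Sym}_{n+1,0}(\mathbb{R})=\{M\oplus\beta: M \text{ symmetric},\ \beta\in\mathbb{R},\ {}^{(s)}\mathrm{tr}(M\oplus\beta)=0\}$. $\mathcal{W}$ is the set of functions $F:\mathbb{R}\to[0,\infty)$ that are non-decreasing, convex, strictly convex on $[0,\infty)$, and satisfy $F'(0)>0$. A real function on a finite-dimensional normed space is coercive if it tends to $+\infty$ as the norm of the argument tends to $\infty$. A measure $\mu$ on $B^n$ is $s$-isotropic if for some $\lambda\neq0$, $\int_{B^n}\big(u\otimes u\oplus(1-|u|_2^2)\big)d\mu(u)=\lambda(\mathrm{Id}\oplus s)$, with $\mathrm{Id}$ the $n\times n$ identity; it is centered if $\int_{B^n}u\,d\mu(u)=0$. As the notation $\bar I_\nu:\mathcal{E}\to\mathbb{R}$ indicates, it is understood that the integrand defining $\bar I_\nu$ makes sense $\nu$-almost everywhere and that the integral is finite for every element of $\mathcal{E}$.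 *)

theory Defs
  imports "HOL-Analysis.Analysis"
begin

section \<open>Proper log-concave functions\<close>

text \<open>An extended convex function never takes the value \<open>-\<infinity>\<close>, so no indefinite sum
  occurs below; \<open>0 * \<infinity> = 0\<close> makes the endpoints \<open>t = 0\<close> and \<open>t = 1\<close> trivial.\<close>

definition ext_convex :: "('a::real_vector \<Rightarrow> ereal) \<Rightarrow> bool" where
  "ext_convex \<phi> \<longleftrightarrow> (\<forall>x. \<phi> x \<noteq> -\<infinity>) \<and>
     (\<forall>x y. \<forall>t\<in>{0..1}. \<phi> ((1 - t) *\<^sub>R x + t *\<^sub>R y) \<le> ereal (1 - t) * \<phi> x + ereal t * \<phi> y)"

definition log_concave_fun :: "('a::real_vector \<Rightarrow> real) \<Rightarrow> bool" where
  "log_concave_fun h \<longleftrightarrow> (\<exists>\<phi>. ext_convex \<phi> \<and>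
     (\<forall>x. h x = (if \<phi> x = \<infinity> then 0 else exp (- real_of_ereal (\<phi> x)))))"

definition upper_semicontinuous :: "('a::topological_space \<Rightarrow> real) \<Rightarrow> bool" where
  "upper_semicontinuous h \<longleftrightarrow> (\<forall>x. \<forall>c>h x. \<forall>\<^sub>F y in nhds x. h y < c)"

definition proper_log_concave :: "('a::euclidean_space \<Rightarrow> real) \<Rightarrow> bool" where
  "proper_log_concave h \<longleftrightarrow> log_concave_fun h \<and> upper_semicontinuous h \<and>
     integrable lborel h \<and> 0 < (LINT x|lborel. h x)"

section \<open>The John s-function\<close>

text \<open>\<open>\<real>\<^sup>n\<^sup>+\<^sup>1\<close> is the product type \<open>(real^'n) \<times> real\<close>, whose norm is the
  Euclidean one.  A block diagonal matrix \<open>A \<oplus> \<alpha>\<close> is encoded as the pair \<open>(A, \<alpha>)\<close>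
  of its blocks; addition and scaling are then componentwise, and the norm on such pairs is
  the Frobenius norm of the block matrix.\<close>

definition block_apply :: "(real^'n^'n) \<times> real \<Rightarrow> (real^'n) \<times> real \<Rightarrow> (real^'n) \<times> real" where
  "block_apply = (\<lambda>(A, \<alpha>) (x, \<xi>). (A *v x, \<alpha> * \<xi>))"

definition sym_mat :: "real^'n^'n \<Rightarrow> bool" where
  "sym_mat A \<longleftrightarrow> transpose A = A"

definition sym_pos_def :: "real^'n^'n \<Rightarrow> bool" where
  "sym_pos_def A \<longleftrightarrow> sym_mat A \<and> (\<forall>x. x \<noteq> 0 \<longrightarrow> 0 < x \<bullet> (A *v x))"

definition n_symmetric_ellipsoids :: "((real^'n) \<times> real) set set" where
  "n_symmetric_ellipsoids =
     {(\<lambda>v. block_apply (A, \<alpha>) v + (a, 0)) ` cball 0 1 | A \<alpha> a. sym_pos_def A \<and> 0 < \<alpha>}"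

definition s_lifting :: "real \<Rightarrow> (real^'n \<Rightarrow> real) \<Rightarrow> ((real^'n) \<times> real) set" where
  "s_lifting s h = {(x, \<xi>). \<bar>\<xi>\<bar> \<le> h x powr (1/s)}"

text \<open>\<open>Pair x -` C\<close> is the section of \<open>C\<close> by the line \<open>l\<^sub>x\<close>, parametrised by its last
  coordinate.  The case distinction extends \<open>powr\<close> to \<open>\<infinity>\<close>, since \<open>measure\<close> would give
  the value 0 on a section of infinite length.\<close>

definition s_volume :: "real \<Rightarrow> ((real^'n) \<times> real) set \<Rightarrow> ennreal" where
  "s_volume s C = (\<integral>\<^sup>+x. (if emeasure lborel (Pair x -` C) = \<infinity> then \<infinity>
      else ennreal ((measure lborel (Pair x -` C) / 2) powr s)) \<partial>lborel)"

definition is_John_s_ellipsoid :: "real \<Rightarrow> (real^'n \<Rightarrow> real) \<Rightarrow> ((real^'n) \<times> real) set \<Rightarrow> bool" where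
  "is_John_s_ellipsoid s h E \<longleftrightarrow>
     E \<in> n_symmetric_ellipsoids \<and> E \<subseteq> s_lifting s h \<and>
     (\<forall>E'\<in>n_symmetric_ellipsoids. E' \<subseteq> s_lifting s h \<longrightarrow> s_volume s E' \<le> s_volume s E)"

definition is_John_s_function :: "real \<Rightarrow> (real^'n \<Rightarrow> real) \<Rightarrow> (real^'n \<Rightarrow> real) \<Rightarrow> bool" where
  "is_John_s_function s h g \<longleftrightarrow>
     (\<exists>E. is_John_s_ellipsoid s h E \<and> g = (\<lambda>x. (measure lborel (Pair x -` E) / 2) powr s))"

definition hslash_ball :: "real^'n \<Rightarrow> real" where
  "hslash_ball x = (if x \<in> cball 0 1 then sqrt (1 - (norm x)\<^sup>2) else 0)"

definition contact_set :: "real \<Rightarrow> (real^'n \<Rightarrow> real) \<Rightarrow> (real^'n) set" where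
  "contact_set s h = {x \<in> cball 0 1. h x powr (1/s) = hslash_ball x}"

section \<open>Measures on the unit ball\<close>

definition measure_support :: "'a::topological_space measure \<Rightarrow> 'a set" where
  "measure_support \<nu> = {x \<in> space \<nu>. \<forall>U. open U \<longrightarrow> x \<in> U \<longrightarrow> 0 < emeasure \<nu> (U \<inter> space \<nu>)}"

definition tensor :: "real^'n \<Rightarrow> real^'n \<Rightarrow> real^'n^'n" where
  "tensor v w = (\<chi> i j. v $ i * w $ j)"

text \<open>The predicate \<open>has_bochner_integral\<close> includes integrability, so that the equations
  cannot hold through the default value 0 of an undefined integral.\<close>

definition centered :: "(real^'n) measure \<Rightarrow> bool" where
  "centered \<mu> \<longleftrightarrow> has_bochner_integral \<mu> (\<lambda>u. u) 0"

definition s_isotropic :: "real \<Rightarrow> (real^'n) measure \<Rightarrow> bool" where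
  "s_isotropic s \<mu> \<longleftrightarrow> (\<exists>l::real. l \<noteq> 0 \<and>
     has_bochner_integral \<mu> (\<lambda>u. (tensor u u, 1 - (norm u)\<^sup>2)) (l *\<^sub>R (mat 1, s)))"

section \<open>The functional\<close>

definition class_W :: "(real \<Rightarrow> real) set" where
  "class_W = {F. (\<forall>x. 0 \<le> F x) \<and> mono F \<and> convex_on UNIV F \<and>
     (\<forall>x\<ge>0. \<forall>y\<ge>0. \<forall>t. x \<noteq> y \<longrightarrow> 0 < t \<longrightarrow> t < 1 \<longrightarrow>
        F ((1 - t) * x + t * y) < (1 - t) * F x + t * F y) \<and>
     (\<exists>D>0. (F has_real_derivative D) (at 0))}"

definition E_space :: "(((real^'n^'n) \<times> real) \<times> (real^'n)) set" where
  "E_space = {((A, \<alpha>), a). sym_mat A}"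

definition s_trace :: "real \<Rightarrow> (real^'n^'n) \<times> real \<Rightarrow> real" where
  "s_trace s = (\<lambda>(M, \<beta>). s * \<beta> + trace M)"

definition s_Sym0 :: "real \<Rightarrow> ((real^'n^'n) \<times> real) set" where
  "s_Sym0 s = {(M, \<beta>). sym_mat M \<and> s_trace s (M, \<beta>) = 0}"

definition functional_arg ::
  "real \<Rightarrow> (real^'n \<Rightarrow> real) \<Rightarrow> ((real^'n^'n) \<times> real) \<times> (real^'n) \<Rightarrow> real^'n \<Rightarrow> real" where
  "functional_arg s h = (\<lambda>((M, \<beta>), w) x. (x \<bullet> (M *v x + w)) / h x powr (2/s) + \<beta>)"

definition integrand_I :: "real \<Rightarrow> (real^'n \<Rightarrow> real) \<Rightarrow> (real \<Rightarrow> real) \<Rightarrow>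
    ((real^'n^'n) \<times> real) \<times> (real^'n) \<Rightarrow> real^'n \<Rightarrow> real" where
  "integrand_I s h F p x = h x powr (1/s) * F (functional_arg s h p x)"

definition I_bar :: "real \<Rightarrow> (real^'n \<Rightarrow> real) \<Rightarrow> (real \<Rightarrow> real) \<Rightarrow> (real^'n) measure \<Rightarrow>
    ((real^'n^'n) \<times> real) \<times> (real^'n) \<Rightarrow> real" where
  "I_bar s h F \<nu> p = (LINT x|\<nu>. integrand_I s h F p x)"

definition min_density :: "real \<Rightarrow> (real^'n \<Rightarrow> real) \<Rightarrow> (real \<Rightarrow> real) \<Rightarrow>
    ((real^'n^'n) \<times> real) \<times> (real^'n) \<Rightarrow> real^'n \<Rightarrow> real" where
  "min_density s h F p x = 1 / h x powr (1/s) * deriv F (functional_arg s h p x)"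

definition coercive_on :: "'a::real_normed_vector set \<Rightarrow> ('a \<Rightarrow> real) \<Rightarrow> bool" where
  "coercive_on V f \<longleftrightarrow> filterlim f at_top (inf at_infinity (principal V))"

definition global_min_on :: "'a set \<Rightarrow> ('a \<Rightarrow> real) \<Rightarrow> 'a \<Rightarrow> bool" where
  "global_min_on V f p \<longleftrightarrow> p \<in> V \<and> (\<forall>q\<in>V. f p \<le> f q)"

end

theory Submission
  imports Defs
begin

text \<open>Since the argument of \<open>F\<close> is affine along lines, convexity of \<open>F\<close> bounds its difference
  quotients by integrable functions, so the functional may be differentiated under the integral
  sign.  On \<open>\<Lambda>\<close> one has \<open>h\<^sup>2\<^sup>/\<^sup>s = 1 - \<bar>x\<bar>\<^sup>2\<close>, hence the derivative in direction \<open>(M \<oplus> \<beta>, w)\<close> is the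
  integral of \<open>\<langle>x, Mx + w\<rangle> + \<beta>(1 - \<bar>x\<bar>\<^sup>2)\<close> against the density in question.  Its vanishing on the
  hyperplane \<open>tr M + s\<beta> = 0\<close> says that the measure is centered and satisfies the isotropy equation.
  If the density vanished, all arguments of \<open>F\<close> would lie in the region left of 0 where \<open>F\<close> is
  constant, and the functional would be constant along the ray through the minimum, against
  coercivity.\<close>

text \<open>Second countability makes the complement of the support a union of countably many null
  basic open sets. The sets \<open>U\<close> are intersected with \<open>space \<nu>\<close> because
  the lemma is applied to a measure living on the ball only.\<close>

lemma AE_in_measure_support:
  fixes \<nu> :: "'a::second_countable_topology measure"
  assumes meas: "\<And>U. open U \<Longrightarrow> U \<inter> space \<nu> \<in> sets \<nu>"
  shows "AE x in \<nu>. x \<in> measure_support \<nu>"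
proof -
  obtain B :: "'a set set" where B: "countable B" "topological_basis B"
    using ex_countable_basis by blast
  define C where "C = {U \<in> B. emeasure \<nu> (U \<inter> space \<nu>) = 0}"
  have "countable C"
    unfolding C_def using B(1) by simp
  moreover have "U \<inter> space \<nu> \<in> null_sets \<nu>" if "U \<in> C" for U
    using that meas topological_basis_open[OF B(2)] by (auto simp: C_def null_sets_def)
  ultimately have "(\<Union>U\<in>C. U \<inter> space \<nu>) \<in> null_sets \<nu>"
    by (rule null_sets_UN')
  moreover have "{x \<in> space \<nu>. x \<notin> measure_support \<nu>} \<subseteq> (\<Union>U\<in>C. U \<inter> space \<nu>)"
  proof
    fix x assume x: "x \<in> {x \<in> space \<nu>. x \<notin> measure_support \<nu>}"
    then obtain U where U: "open U" "x \<in> U" "emeasure \<nu> (U \<inter> space \<nu>) = 0"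
      unfolding measure_support_def by (auto simp: not_less)
    obtain V where V: "V \<in> B" "x \<in> V" "V \<subseteq> U"
      using topological_basisE[OF B(2) U(1,2)] by blast
    have "emeasure \<nu> (V \<inter> space \<nu>) \<le> emeasure \<nu> (U \<inter> space \<nu>)"
      using V(3) meas[OF U(1)] by (intro emeasure_mono) auto
    then have "V \<in> C"
      using V(1) U(3) by (simp add: C_def)
    then show "x \<in> (\<Union>U\<in>C. U \<inter> space \<nu>)"
      using x V(2) by auto
  qed
  ultimately show ?thesis
    by (rule AE_I'[rotated -1, rotated])
qed

text \<open>Expansion in the standard basis; it reduces the vector and matrix identities of the
  theorem to scalar ones.\<close>

lemma has_bochner_integral_componentwise:
  fixes f :: "'a \<Rightarrow> 'b::euclidean_space"
  assumes "\<And>b. b \<in> Basis \<Longrightarrow> has_bochner_integral M (\<lambda>x. f x \<bullet> b) (l \<bullet> b)"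
  shows "has_bochner_integral M f l"
proof -
  have "has_bochner_integral M (\<lambda>x. \<Sum>b\<in>Basis. (f x \<bullet> b) *\<^sub>R b) (\<Sum>b\<in>Basis. (l \<bullet> b) *\<^sub>R b)"
    using assms by (intro has_bochner_integral_sum has_bochner_integral_scaleR_left) auto
  then show ?thesis
    by (simp add: euclidean_representation)
qed

lemma tensor_mult_vec: "tensor u v *v x = (v \<bullet> x) *\<^sub>R u"
  by (simp add: vec_eq_iff tensor_def matrix_vector_mult_def inner_vec_def sum_distrib_left
      sum_distrib_right mult_ac)

lemma trace_tensor: "trace (tensor u v) = u \<bullet> v"
  by (simp add: trace_def tensor_def inner_vec_def)

lemma sym_mat_tensor_add: "sym_mat (tensor u v + tensor v u)"
  by (simp add: sym_mat_def transpose_def tensor_def vec_eq_iff mult.commute add.commute)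

text \<open>For convex \<open>F\<close> the quotient lies between \<open>F a - F (a - b)\<close> and
  \<open>F (a + b) - F a\<close>. The resulting bound is free of \<open>t\<close> and serves as a
  majorant for dominated convergence.\<close>

lemma convex_diff_quotient_bound:
  fixes F :: "real \<Rightarrow> real"
  assumes conv: "convex_on UNIV F" and D: "\<And>x. (F has_real_derivative F' x) (at x)"
    and t: "0 < t" "t \<le> 1"
  shows "\<bar>(F (a + t * b) - F a) / t\<bar> \<le> \<bar>F (a + b) - F a\<bar> + \<bar>F (a - b) - F a\<bar>"
proof -
  have tangent: "F' x * (y - x) \<le> F y - F x" for x y
    by (rule convex_on_imp_above_tangent[OF conv]) (auto simp: D has_field_derivative_at_within)
  have "F ((1 - t) *\<^sub>R a + t *\<^sub>R (a + b)) \<le> (1 - t) * F a + t * F (a + b)"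
    using t by (intro convex_onD[OF conv]) auto
  then have "F (a + t * b) - F a \<le> t * (F (a + b) - F a)"
    by (simp add: algebra_simps)
  then have upper: "(F (a + t * b) - F a) / t \<le> F (a + b) - F a"
    using t by (simp add: field_simps)
  \<comment> \<open>The lower bound passes through the slope at \<open>a\<close>: the tangent there
    lies below \<open>F\<close> both at \<open>a + t * b\<close> and at
    \<open>a - b\<close>.\<close>
  have "t * (F' a * b) \<le> F (a + t * b) - F a"
    using tangent[of a "a + t * b"] by (simp add: algebra_simps)
  moreover have "t * (F a - F (a - b)) \<le> t * (F' a * b)"
    using tangent[of a "a - b"] t by (intro mult_left_mono) auto
  ultimately have "F a - F (a - b) \<le> (F (a + t * b) - F a) / t"
    using t by (simp add: field_simps)
  with upper show ?thesis by linarith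
qed

text \<open>Dominated convergence for difference quotients with positive steps tending to 0.
  Positive steps yield only the sign of the derivative; that it vanishes follows later from the
  opposite direction.\<close>

lemma
  fixes F F' :: "real \<Rightarrow> real" and k a b :: "'a \<Rightarrow> real"
  assumes conv: "convex_on UNIV F" and D: "\<And>x. (F has_real_derivative F' x) (at x)"
    and k: "\<And>x. 0 \<le> k x"
    and int: "\<And>t. integrable M (\<lambda>x. k x * F (a x + t * b x))"
  shows integrable_convex_directional_deriv: "integrable M (\<lambda>x. k x * (F' (a x) * b x))"
    and integral_convex_directional_deriv_nonneg:
      "(\<And>t. (LINT x|M. k x * F (a x)) \<le> (LINT x|M. k x * F (a x + t * b x))) \<Longrightarrow>
        0 \<le> (LINT x|M. k x * (F' (a x) * b x))"
proof -
  define t :: "nat \<Rightarrow> real" where "t n = inverse (real (Suc n))" for n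
  define X where "X n x = (k x * F (a x + t n * b x) - k x * F (a x)) / t n" for n x
  \<comment> \<open>The majorant is written with the factors \<open>1\<close>, \<open>0\<close> and
    \<open>-1\<close> so that each term is an instance of \<open>int\<close>.\<close>
  define w where "w x = \<bar>k x * F (a x + 1 * b x) - k x * F (a x + 0 * b x)\<bar>
    + \<bar>k x * F (a x + (-1) * b x) - k x * F (a x + 0 * b x)\<bar>" for x
  have t: "0 < t n" "t n \<le> 1" for n
    by (auto simp: t_def field_simps)
  have t0: "t \<longlonglongrightarrow> 0"
    unfolding t_def by (rule LIMSEQ_inverse_real_of_nat)
  have int0: "integrable M (\<lambda>x. k x * F (a x))"
    using int[of 0] by simp
  have intX: "integrable M (X n)" for n
    unfolding X_def by (intro integrable_divide Bochner_Integration.integrable_diff int int0)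
  have lim: "(\<lambda>n. X n x) \<longlonglongrightarrow> k x * (F' (a x) * b x)" for x
  proof -
    have "((\<lambda>r. F (a x + r * b x)) has_real_derivative F' (a x + 0 * b x) * b x) (at 0)"
      by (rule DERIV_chain2[OF D]) (auto intro!: derivative_eq_intros)
    then have "((\<lambda>r. (F (a x + r * b x) - F (a x)) / r) \<longlongrightarrow> F' (a x) * b x) (at 0)"
      by (simp add: DERIV_def)
    moreover have "filterlim t (at 0) sequentially"
      using less_imp_neq[OF t(1), symmetric] by (simp add: filterlim_at t0)
    ultimately have "(\<lambda>n. (F (a x + t n * b x) - F (a x)) / t n) \<longlonglongrightarrow> F' (a x) * b x"
      by (rule filterlim_compose)
    then have "(\<lambda>n. k x * ((F (a x + t n * b x) - F (a x)) / t n)) \<longlonglongrightarrow> k x * (F' (a x) * b x)"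
      by (intro tendsto_intros)
    then show ?thesis
      by (simp add: X_def right_diff_distrib)
  qed
  have bound: "norm (X n x) \<le> w x" for n x
  proof -
    have "X n x = k x * ((F (a x + t n * b x) - F (a x)) / t n)"
      by (simp add: X_def right_diff_distrib)
    then have "norm (X n x) = k x * \<bar>(F (a x + t n * b x) - F (a x)) / t n\<bar>"
      using k[of x] by (simp only: real_norm_def abs_mult abs_of_nonneg)
    also have "\<dots> \<le> k x * (\<bar>F (a x + b x) - F (a x)\<bar> + \<bar>F (a x - b x) - F (a x)\<bar>)"
      by (intro mult_left_mono convex_diff_quotient_bound[OF conv D t] k)
    also have "\<dots> = \<bar>k x * (F (a x + b x) - F (a x))\<bar> + \<bar>k x * (F (a x - b x) - F (a x))\<bar>"
      using k[of x] by (simp only: abs_mult abs_of_nonneg distrib_left)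
    also have "\<dots> = w x"
      by (simp add: w_def right_diff_distrib)
    finally show ?thesis .
  qed
  have w: "integrable M w"
    unfolding w_def by (intro Bochner_Integration.integrable_add integrable_abs
        Bochner_Integration.integrable_diff int)
  \<comment> \<open>Measurability of \<open>a\<close> and \<open>b\<close> is not assumed; the
    integrand is measurable as a pointwise limit of the integrable quotients.\<close>
  have meas: "(\<lambda>x. k x * (F' (a x) * b x)) \<in> borel_measurable M"
    by (rule borel_measurable_LIMSEQ_real[OF lim borel_measurable_integrable[OF intX]])
  show "integrable M (\<lambda>x. k x * (F' (a x) * b x))"
    by (rule integrable_dominated_convergence[where s=X, OF meas borel_measurable_integrable[OF intX] w])
      (use lim bound in auto)
  assume min: "\<And>t. (LINT x|M. k x * F (a x)) \<le> (LINT x|M. k x * F (a x + t * b x))"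
  have "(\<lambda>n. LINT x|M. X n x) \<longlonglongrightarrow> (LINT x|M. k x * (F' (a x) * b x))"
    by (rule integral_dominated_convergence[OF meas borel_measurable_integrable[OF intX] w])
      (use lim bound in auto)
  moreover have "0 \<le> (LINT x|M. X n x)" for n
    unfolding X_def using min[of "t n"] t(1)[of n] int int0 by simp
  ultimately show "0 \<le> (LINT x|M. k x * (F' (a x) * b x))"
    by (intro LIMSEQ_le_const) auto
qed

text \<open>Linearity in the parameter holds at every \<open>x\<close>: where \<open>h x = 0\<close>
  the quotient is 0 by the convention for division by zero.\<close>

lemma functional_arg_add_scaleR:
  "functional_arg s h (p + t *\<^sub>R q) x = functional_arg s h p x + t * functional_arg s h q x"
  by (cases p; cases q)
    (auto simp: functional_arg_def matrix_vector_mult_add_rdistrib scaleR_matrix_vector_assoc[symmetric]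
      inner_simps add_divide_distrib algebra_simps)

lemma functional_arg_scaleR: "functional_arg s h (t *\<^sub>R q) x = t * functional_arg s h q x"
proof -
  have "functional_arg s h 0 x = 0"
    by (simp add: functional_arg_def zero_prod_def)
  then show ?thesis
    using functional_arg_add_scaleR[of s h 0 t q x] by simp
qed

lemma sym_mat_add: "sym_mat A \<Longrightarrow> sym_mat B \<Longrightarrow> sym_mat (A + B)"
  by (simp add: sym_mat_def transpose_def vec_eq_iff)

lemma sym_mat_scaleR: "sym_mat A \<Longrightarrow> sym_mat (c *\<^sub>R A)"
  by (simp add: sym_mat_def transpose_def vec_eq_iff)

lemma subspace_E_space: "subspace E_space"
  unfolding subspace_def E_space_def
  by (auto simp: sym_mat_add sym_mat_scaleR zero_prod_def)
    (simp add: sym_mat_def transpose_def vec_eq_iff)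

lemma subspace_s_Sym0: "subspace (s_Sym0 s)"
proof -
  have [simp]: "trace (c *\<^sub>R A) = c * trace A" for c and A :: "real^'n^'n"
    by (simp add: trace_def sum_distrib_left)
  have [simp]: "trace (0 :: real^'n^'n) = 0"
    by (simp add: trace_def)
  show ?thesis
    unfolding subspace_def s_Sym0_def s_trace_def zero_prod_def
    by (auto simp: sym_mat_add sym_mat_scaleR trace_add algebra_simps)
      (simp_all add: sym_mat_def transpose_def vec_eq_iff flip: distrib_left)
qed

lemma s_Sym0_times_UNIV_subset_E_space: "s_Sym0 s \<times> UNIV \<subseteq> E_space"
  by (auto simp: s_Sym0_def E_space_def)

text \<open>Composing \<open>F\<close> with an argument linear in the parameter and multiplying by a
  nonnegative weight preserves convexity pointwise, hence under the integral.\<close>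

lemma convex_on_I_bar:
  fixes h :: "real^'n \<Rightarrow> real"
  assumes F: "convex_on UNIV F"
    and int: "\<And>p. p \<in> E_space \<Longrightarrow> integrable \<nu> (integrand_I s h F p)"
  shows "convex_on E_space (I_bar s h F \<nu>)"
proof (rule convex_onI)
  show E: "convex E_space"
    by (rule subspace_imp_convex[OF subspace_E_space])
  fix t :: real and p q :: "((real^'n^'n) \<times> real) \<times> (real^'n)"
  assume t: "0 < t" "t < 1" and p: "p \<in> E_space" and q: "q \<in> E_space"
  have r: "(1 - t) *\<^sub>R p + t *\<^sub>R q \<in> E_space"
    using convexD_alt[OF E p q] t by auto
  have "I_bar s h F \<nu> ((1 - t) *\<^sub>R p + t *\<^sub>R q)
      \<le> (LINT x|\<nu>. (1 - t) * integrand_I s h F p x + t * integrand_I s h F q x)"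
    unfolding I_bar_def
  proof (rule integral_mono)
    fix x
    have "F ((1 - t) *\<^sub>R functional_arg s h p x + t *\<^sub>R functional_arg s h q x)
        \<le> (1 - t) * F (functional_arg s h p x) + t * F (functional_arg s h q x)"
      using t by (intro convex_onD[OF F]) auto
    then have "h x powr (1/s) * F (functional_arg s h ((1 - t) *\<^sub>R p + t *\<^sub>R q) x)
        \<le> h x powr (1/s) * ((1 - t) * F (functional_arg s h p x) + t * F (functional_arg s h q x))"
      by (intro mult_left_mono) (auto simp: functional_arg_add_scaleR functional_arg_scaleR)
    then show "integrand_I s h F ((1 - t) *\<^sub>R p + t *\<^sub>R q) x
        \<le> (1 - t) * integrand_I s h F p x + t * integrand_I s h F q x"
      by (simp add: integrand_I_def algebra_simps)
  qed (use int p q r in auto)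
  also have "\<dots> = (1 - t) * I_bar s h F \<nu> p + t * I_bar s h F \<nu> q"
    using int p q by (simp add: I_bar_def)
  finally show "I_bar s h F \<nu> ((1 - t) *\<^sub>R p + t *\<^sub>R q)
      \<le> (1 - t) * I_bar s h F \<nu> p + t * I_bar s h F \<nu> q" .
qed

lemma not_coercive_on_if_const_on_ray:
  assumes "p \<noteq> 0" and "\<And>c. 1 \<le> c \<Longrightarrow> c *\<^sub>R p \<in> V" and "\<And>c. 1 \<le> c \<Longrightarrow> f (c *\<^sub>R p) = f p"
  shows "\<not> coercive_on V f"
proof
  assume co: "coercive_on V f"
  have "filterlim (\<lambda>c. c *\<^sub>R p) at_infinity (at_top :: real filter)"
  proof (rule filterlim_at_infinity_conv_norm_at_top[THEN iffD2])
    have "filterlim (\<lambda>c::real. norm p * \<bar>c\<bar>) at_top at_top"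
      using assms(1)
      by (intro filterlim_tendsto_pos_mult_at_top[OF tendsto_const] filterlim_abs_real) auto
    then show "filterlim (\<lambda>c. norm (c *\<^sub>R p)) at_top (at_top :: real filter)"
      by (simp add: mult.commute)
  qed
  moreover have "filterlim (\<lambda>c. c *\<^sub>R p) (principal V) (at_top :: real filter)"
    unfolding filterlim_principal
    using eventually_ge_at_top[of 1] by eventually_elim (rule assms(2))
  ultimately have "filterlim (\<lambda>c. f (c *\<^sub>R p)) at_top (at_top :: real filter)"
    using co unfolding coercive_on_def by (auto intro: filterlim_compose simp: filterlim_inf)
  then have "\<forall>\<^sub>F c in at_top. f p + 1 \<le> f (c *\<^sub>R p)"
    by (simp add: filterlim_at_top)
  with eventually_ge_at_top[of 1] have "\<forall>\<^sub>F c in (at_top :: real filter). False"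
    by eventually_elim (use assms(3) in force)
  then show False
    by simp
qed

text \<open>A convex function with positive slope at 0 can have a horizontal tangent only to the
  left of 0. Further left, monotonicity bounds \<open>F\<close> above by \<open>F a\<close> and the
  horizontal tangent bounds it below by \<open>F a\<close>.\<close>

lemma deriv_zero_imp_const_on_ray:
  fixes F :: "real \<Rightarrow> real"
  assumes F: "F \<in> class_W" and D: "\<And>x. (F has_real_derivative F' x) (at x)" and z: "F' a = 0"
  shows "a < 0" and "1 \<le> c \<Longrightarrow> F (c * a) = F a"
proof -
  have tangent: "F' x * (y - x) \<le> F y - F x" for x y
    using F by (intro convex_on_imp_above_tangent[of UNIV])
      (auto simp: D has_field_derivative_at_within class_W_def)
  obtain d where d: "d > 0" "(F has_real_derivative d) (at 0)"
    using F by (auto simp: class_W_def)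
  then have "F' 0 > 0"
    using DERIV_unique[OF D] by metis
  \<comment> \<open>For positive \<open>a\<close> the tangent at 0 would give
    \<open>F a > F 0\<close>, the horizontal tangent at \<open>a\<close> the reverse.\<close>
  have "\<not> 0 < a"
  proof
    assume "0 < a"
    then have "0 < F' 0 * a"
      using \<open>F' 0 > 0\<close> by simp
    then show False
      using tangent[of 0 a] tangent[of a 0] z by simp
  qed
  moreover have "a \<noteq> 0"
    using z \<open>F' 0 > 0\<close> by auto
  ultimately show "a < 0"
    by simp
  assume "1 \<le> c"
  then have "c * a \<le> a"
    using \<open>a < 0\<close> by simp
  then have "F (c * a) \<le> F a"
    using F by (auto simp: class_W_def dest: monoD)
  with tangent[of a "c * a"] z show "F (c * a) = F a"
    by simp
qed

theorem theorem1p2: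
  fixes s :: real and h :: "real^'n \<Rightarrow> real" and \<nu> :: "(real^'n) measure" and F :: "real \<Rightarrow> real"
  assumes "0 < s"
    and "proper_log_concave h"
    and "is_John_s_function s h (\<lambda>x. hslash_ball x powr s)"
    and "sets \<nu> = sets (restrict_space borel (cball 0 1))"
    and "finite_measure \<nu>"
    and "emeasure \<nu> (space \<nu>) \<noteq> 0"
    and "measure_support \<nu> \<subseteq> contact_set s h"
    and "F \<in> class_W"
    and "F C1_differentiable_on UNIV"
    and "AE x in \<nu>. h x \<noteq> 0"
    and "\<And>p. p \<in> E_space \<Longrightarrow> integrable \<nu> (integrand_I s h F p)"
  shows "convex_on E_space (I_bar s h F \<nu>) \<and>
    (coercive_on (s_Sym0 s \<times> UNIV) (I_bar s h F \<nu>) \<longrightarrow>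
      (\<forall>p. global_min_on (s_Sym0 s \<times> UNIV) (I_bar s h F \<nu>) p \<longrightarrow>
        (let g = min_density s h F p; \<mu> = density \<nu> (\<lambda>x. ennreal (g x)) in
          g \<in> borel_measurable \<nu> \<and> (AE x in \<nu>. 0 \<le> g x) \<and> emeasure \<mu> (space \<mu>) \<noteq> 0 \<and>
          centered \<mu> \<and> s_isotropic s \<mu>)))"
proof (intro conjI impI allI)
  let ?I = "I_bar s h F \<nu>" and ?V = "s_Sym0 s \<times> (UNIV :: (real^'n) set)"
  have conv: "convex_on UNIV F" and mono: "mono F"
    using assms(8) by (auto simp: class_W_def)
  show "convex_on E_space ?I"
    using conv assms(11) by (rule convex_on_I_bar)
  assume co: "coercive_on ?V ?I"
  fix p assume "global_min_on ?V ?I p"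
  then have pV: "p \<in> ?V" and min: "\<And>q. q \<in> ?V \<Longrightarrow> ?I p \<le> ?I q"
    by (auto simp: global_min_on_def)
  have V: "subspace ?V"
    by (intro subspace_Times subspace_s_Sym0 subspace_UNIV)
  have pE: "p \<in> E_space"
    using pV s_Sym0_times_UNIV_subset_E_space by blast
  define g where "g = min_density s h F p"
  let ?a = "functional_arg s h"
  define k where "k x = h x powr (1/s)" for x

  \<comment> \<open>Sign and measurability of the density\<close>
  obtain F' where F': "\<And>x. (F has_vector_derivative F' x) (at x)" "continuous_on UNIV F'"
    using assms(9) by (auto simp: C1_differentiable_on_def)
  have D: "(F has_real_derivative F' x) (at x)" for x
    using F'(1) by (simp add: has_real_derivative_iff_has_vector_derivative)
  have dF: "deriv F = F'"
    using D by (auto intro: DERIV_imp_deriv)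
  have F'_nonneg: "0 \<le> F' x" for x
    using mono_on_imp_deriv_nonneg[of UNIV F "F' x" x] mono D by (auto simp: mono_on_def dest: monoD)
  have g_eq: "g x = F' (?a p x) / k x" for x
    by (simp add: g_def min_density_def k_def dF)
  have g_nonneg: "0 \<le> g x" for x
    using F'_nonneg by (simp add: g_eq k_def)

  have sp: "space \<nu> = cball 0 1"
    using sets_eq_imp_space_eq[OF assms(4)] by (simp add: space_restrict_space)
  have borel_\<nu>: "f \<in> borel_measurable \<nu>" if "f \<in> borel_measurable borel"
    for f :: "real^'n \<Rightarrow> 'b::topological_space"
    using measurable_restrict_space1[OF that] measurable_cong_sets[OF assms(4) refl] by blast
  have [measurable]: "h \<in> borel_measurable borel"
    using assms(2) borel_measurable_integrable by (fastforce simp: proper_log_concave_def)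
  have [measurable]: "F' \<in> borel_measurable borel"
    using F'(2) by (rule borel_measurable_continuous_onI)
  obtain M\<^sub>0 \<beta>\<^sub>0 w\<^sub>0 where p: "p = ((M\<^sub>0, \<beta>\<^sub>0), w\<^sub>0)"
    by (metis prod.exhaust)
  have [measurable]: "(\<lambda>x. M\<^sub>0 *v x) \<in> borel_measurable borel"
    by (intro borel_measurable_continuous_onI continuous_intros)
  have g_meas[measurable]: "g \<in> borel_measurable \<nu>"
  proof (rule borel_\<nu>)
    show "g \<in> borel_measurable borel"
      unfolding g_def min_density_def functional_arg_def p dF prod.case by measurable
  qed

  \<comment> \<open>Almost everywhere identities on the contact set\<close>
  have "AE x in \<nu>. x \<in> measure_support \<nu>"
  proof (rule AE_in_measure_support)
    fix U :: "(real^'n) set" assume "open U"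
    then show "U \<inter> space \<nu> \<in> sets \<nu>"
      unfolding sp assms(4) by (auto simp: sets_restrict_space)
  qed
  \<comment> \<open>Contact points on the unit sphere have \<open>k x = 0\<close>; they are excluded
    because \<open>h\<close> is nonzero almost everywhere.\<close>
  then have ae: "AE x in \<nu>. 0 < k x \<and> (k x)\<^sup>2 = 1 - (norm x)\<^sup>2 \<and> h x powr (2/s) = (k x)\<^sup>2"
    using assms(10)
  proof eventually_elim
    case (elim x)
    then have x: "norm x \<le> 1" "k x = sqrt (1 - (norm x)\<^sup>2)"
      using assms(7) by (auto simp: contact_set_def hslash_ball_def k_def)
    have "(norm x)\<^sup>2 \<le> 1"
      using x(1) by (simp add: power_le_one)
    moreover have "h x powr (2/s) = (k x)\<^sup>2"
      by (simp add: k_def power2_eq_square flip: powr_add)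
    moreover have "0 < k x"
      using elim by (simp add: k_def)
    ultimately show ?case
      using x(2) by simp
  qed

  \<comment> \<open>First-order condition at the minimum\<close>
  define P where "P = (\<lambda>((M, \<beta>), w) x :: real^'n. (x \<bullet> (M *v x + w)) + \<beta> * (1 - (norm x)\<^sup>2))"
  \<comment> \<open>\<open>P q\<close> is the argument of \<open>F\<close> in direction
    \<open>q\<close> with the denominator cleared:
    \<open>(k x)\<^sup>2 = 1 - (norm x)\<^sup>2\<close> turns the summand \<beta> into its second
    term. One factor \<open>k x\<close> is absorbed by
    \<open>g x * k x = F' (?a p x)\<close>.\<close>
  have P_eq: "AE x in \<nu>. k x * (F' (?a p x) * ?a q x) = g x * P q x" for q
    using ae
  proof eventually_elim
    case (elim x)
    obtain M \<beta> w where q: "q = ((M, \<beta>), w)"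
      by (metis prod.exhaust)
    have "1 - (norm x)\<^sup>2 = (k x)\<^sup>2" "h x powr (2/s) = (k x)\<^sup>2" "k x \<noteq> 0"
      using elim by auto
    then have "(k x)\<^sup>2 * ?a q x = P q x"
      by (simp add: q functional_arg_def P_def distrib_left)
    then have "g x * P q x = g x * k x * (k x * ?a q x)"
      by (simp add: power2_eq_square mult_ac)
    then show ?case
      using elim by (simp add: g_eq)
  qed
  have intF: "integrable \<nu> (\<lambda>x. k x * F (?a p x + t * ?a q x))" if "q \<in> E_space" for q t
  proof -
    have "p + t *\<^sub>R q \<in> E_space"
      by (intro subspace_add[OF subspace_E_space] subspace_scale[OF subspace_E_space] pE that)
    from assms(11)[OF this] show ?thesis
      by (simp add: integrand_I_def[abs_def] functional_arg_add_scaleR k_def)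
  qed
  have k_nonneg: "0 \<le> k x" for x
    by (simp add: k_def)
  have P_meas[measurable]: "P q \<in> borel_measurable \<nu>" for q
  proof (rule borel_\<nu>)
    show "P q \<in> borel_measurable borel"
      unfolding P_def case_prod_beta by (intro borel_measurable_continuous_onI continuous_intros)
  qed
  have int_P: "integrable \<nu> (\<lambda>x. g x * P q x)" if "q \<in> E_space" for q
  proof -
    have "integrable \<nu> (\<lambda>x. k x * (F' (?a p x) * ?a q x))"
      by (rule integrable_convex_directional_deriv[OF conv D k_nonneg intF[OF that]])
    then show ?thesis
      by (rule integrable_cong_AE_imp) (use P_eq[of q] in auto)
  qed
  have deriv_nonneg: "0 \<le> (LINT x|\<nu>. g x * P q x)" if "q \<in> ?V" for q
  proof -
    have qE: "q \<in> E_space"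
      using that s_Sym0_times_UNIV_subset_E_space by blast
    have eq: "?I (p + t *\<^sub>R q) = (LINT x|\<nu>. k x * F (?a p x + t * ?a q x))" for t
      by (simp add: I_bar_def integrand_I_def functional_arg_add_scaleR k_def)
    have "p + t *\<^sub>R q \<in> ?V" for t
      by (intro subspace_add[OF V] subspace_scale[OF V] pV that)
    \<comment> \<open>Writing \<open>p\<close> as \<open>p + 0 *\<^sub>R q\<close> lets
      \<open>eq\<close> rewrite both sides.\<close>
    then have "?I (p + 0 *\<^sub>R q) \<le> ?I (p + t *\<^sub>R q)" for t
      using min by simp
    then have "0 \<le> (LINT x|\<nu>. k x * (F' (?a p x) * ?a q x))"
      unfolding eq
      by (intro integral_convex_directional_deriv_nonneg[OF conv D k_nonneg intF[OF qE]]) simp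
    also have "\<dots> = (LINT x|\<nu>. g x * P q x)"
      using P_eq[of q] integrable_convex_directional_deriv[OF conv D k_nonneg intF[OF qE]]
      by (intro integral_cong_AE) auto
    finally show ?thesis .
  qed
  \<comment> \<open>The constraint set is a subspace, so the inequality holds for \<open>q\<close>
    and for \<open>- q\<close>; since \<open>P\<close> is linear in the direction, the integral is
    0.\<close>
  have has_int_zero: "has_bochner_integral \<nu> (\<lambda>x. g x * P q x) 0" if "q \<in> ?V" for q
  proof -
    have "- q \<in> ?V"
      by (rule subspace_neg[OF V that])
    moreover have "P (- q) x = - P q x" for x
    proof -
      have "(- A) *v x = - (A *v x)" for A :: "real^'n^'n"
        by (simp add: matrix_vector_mult_def vec_eq_iff sum_negf)
      then show ?thesis
        by (cases q) (auto simp: P_def inner_simps)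
    qed
    ultimately have "0 \<le> - (LINT x|\<nu>. g x * P q x)"
      using deriv_nonneg[of "- q"] by simp
    with deriv_nonneg[OF that] have "(LINT x|\<nu>. g x * P q x) = 0"
      by simp
    then show ?thesis
      using int_P[OF subsetD[OF s_Sym0_times_UNIV_subset_E_space that]]
      by (simp add: has_bochner_integral_iff)
  qed

  \<comment> \<open>Nonvanishing of the density from coercivity\<close>
  have g_nonzero: "\<not> (AE x in \<nu>. g x = 0)"
  proof
    assume "AE x in \<nu>. g x = 0"
    with ae have z: "AE x in \<nu>. F' (?a p x) = 0"
      by eventually_elim (auto simp: g_eq)
    \<comment> \<open>A ray needs a nonzero generator. At \<open>p = 0\<close> every argument of
      \<open>F\<close> is 0, which is not a zero of \<open>F'\<close>, while \<nu> is
      nonzero.\<close>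
    have "p \<noteq> 0"
    proof
      assume "p = 0"
      then have a0: "?a p x = 0" for x
        by (simp add: functional_arg_def zero_prod_def)
      from z have "AE x in \<nu>. False"
        by eventually_elim (use a0 deriv_zero_imp_const_on_ray(1)[OF assms(8) D] in force)
      then show False
        using assms(6) by (simp add: AE_iff_null null_sets_def)
    qed
    moreover have "c *\<^sub>R p \<in> ?V" for c
      by (rule subspace_scale[OF V pV])
    moreover have "?I (c *\<^sub>R p) = ?I p" if "1 \<le> c" for c
    proof -
      have "AE x in \<nu>. integrand_I s h F (c *\<^sub>R p) x = integrand_I s h F p x"
        using z by eventually_elim
          (simp add: integrand_I_def functional_arg_scaleR
            deriv_zero_imp_const_on_ray(2)[OF assms(8) D _ that])
      moreover have "c *\<^sub>R p \<in> E_space"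
        by (rule subspace_scale[OF subspace_E_space pE])
      ultimately show ?thesis
        unfolding I_bar_def using assms(11) pE by (intro integral_cong_AE) auto
    qed
    ultimately show False
      using not_coercive_on_if_const_on_ray co by blast
  qed

  \<comment> \<open>The scalar moments of the density\<close>
  define l where "l = (LINT x|\<nu>. g x * (1 - (norm x)\<^sup>2)) / s"
  have int_norm: "integrable \<nu> (\<lambda>x. g x * (1 - (norm x)\<^sup>2))"
    \<comment> \<open>This direction has s-trace \<open>s\<close>, hence lies outside the constraint
      subspace; only integrability is taken from it, and the value of the integral defines
      \<open>l\<close>.\<close>
    using int_P[of "((0, 1), 0)"] by (simp add: P_def E_space_def sym_mat_def transpose_def vec_eq_iff)
  have "l \<noteq> 0"
  proof
    assume "l = 0"
    then have "(LINT x|\<nu>. g x * (1 - (norm x)\<^sup>2)) = 0"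
      using assms(1) by (simp add: l_def)
    \<comment> \<open>The second factor is \<open>(k x)\<^sup>2\<close>, positive almost everywhere,
      so a zero integral would force \<open>g\<close> to vanish almost everywhere.\<close>
    moreover have "AE x in \<nu>. 0 \<le> g x * (1 - (norm x)\<^sup>2)"
      using ae by eventually_elim (metis g_nonneg mult_nonneg_nonneg zero_le_power2)
    ultimately have "AE x in \<nu>. g x * (1 - (norm x)\<^sup>2) = 0"
      using integral_nonneg_eq_0_iff_AE[OF int_norm] by blast
    with ae have "AE x in \<nu>. g x = 0"
      by eventually_elim auto
    with g_nonzero show False ..
  qed
  have has_int_norm: "has_bochner_integral \<nu> (\<lambda>x. g x * (1 - (norm x)\<^sup>2)) (l * s)"
    using int_norm assms(1) by (simp add: has_bochner_integral_iff l_def)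
  have has_int_linear: "has_bochner_integral \<nu> (\<lambda>x. g x * (x \<bullet> w)) 0" for w
  proof -
    have "((0, 0), w) \<in> ?V"
      using subspace_0[OF subspace_s_Sym0[of s]] by (auto simp: zero_prod_def)
    then show ?thesis
      using has_int_zero[of "((0, 0), w)"] by (simp add: P_def)
  qed
  have has_int_quadratic: "has_bochner_integral \<nu> (\<lambda>x. g x * ((x \<bullet> u) * (x \<bullet> v))) (l * (u \<bullet> v))" for u v
  proof -
    \<comment> \<open>A symmetrized tensor is an admissible direction whose quadratic form is twice
      the wanted product; \<beta> below is the value that makes its s-trace 0.\<close>
    define S where "S = tensor u v + tensor v u"
    have S: "sym_mat S" "trace S = 2 * (u \<bullet> v)" "x \<bullet> (S *v x) = 2 * ((x \<bullet> u) * (x \<bullet> v))" for x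
      by (simp_all add: S_def sym_mat_tensor_add trace_add trace_tensor inner_commute
          matrix_vector_mult_add_rdistrib tensor_mult_vec inner_simps)
    define \<beta> where "\<beta> = - (2 * (u \<bullet> v) / s)"
    have q: "((S, \<beta>), 0) \<in> ?V"
      using S assms(1) by (simp add: s_Sym0_def s_trace_def \<beta>_def)
    then have "has_bochner_integral \<nu> (\<lambda>x. g x * P ((S, \<beta>), 0) x) 0"
      by (rule has_int_zero)
    \<comment> \<open>Removing the \<beta> term of \<open>P\<close> leaves
      \<open>- (\<beta> * (l * s))\<close>, which is \<open>2 * l * (u \<bullet> v)\<close>: the
      same \<open>l\<close> governs both diagonal blocks.\<close>
    from has_bochner_integral_diff[OF this has_bochner_integral_mult_right[OF has_int_norm, of \<beta>]]
    have "has_bochner_integral \<nu> (\<lambda>x. 2 * (g x * ((x \<bullet> u) * (x \<bullet> v)))) (- (\<beta> * (l * s)))"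
      by (simp add: P_def S algebra_simps)
    from has_bochner_integral_mult_right[OF this, of "1/2"] show ?thesis
      using assms(1) by (simp add: \<beta>_def mult.commute)
  qed

  \<comment> \<open>Transfer to the weighted measure\<close>
  let ?\<mu> = "density \<nu> (\<lambda>x. ennreal (g x))"
  have "centered ?\<mu>"
    unfolding centered_def
  proof (rule has_bochner_integral_density)
    show "has_bochner_integral \<nu> (\<lambda>x. g x *\<^sub>R x) 0"
      by (rule has_bochner_integral_componentwise) (simp add: has_int_linear)
    show "(\<lambda>u. u) \<in> borel_measurable \<nu>"
      by (rule borel_\<nu>) simp
  qed (use g_nonneg in auto)
  moreover have "has_bochner_integral ?\<mu> (\<lambda>u. (tensor u u, 1 - (norm u)\<^sup>2)) (l *\<^sub>R (mat 1, s))"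
  proof (rule has_bochner_integral_componentwise)
    fix b :: "(real^'n^'n) \<times> real" assume "b \<in> Basis"
    \<comment> \<open>The basis consists of the matrix units, handled by the quadratic moments of
      two coordinate vectors, and the last coordinate, handled by the definition of
      \<open>l\<close>.\<close>
    then consider i j where "b = (axis i (axis j 1), 0)" | "b = (0, 1)"
      by (auto simp: Basis_prod_def Basis_vec_def)
    then have "has_bochner_integral \<nu> (\<lambda>x. g x *\<^sub>R ((tensor x x, 1 - (norm x)\<^sup>2) \<bullet> b)) ((l *\<^sub>R (mat 1, s)) \<bullet> b)"
    proof cases
      case 1
      have "axis i (1::real) $ j = (if i = j then 1 else 0)"
        by (auto simp: axis_def)
      then show ?thesis
        using has_int_quadratic[of "axis i 1" "axis j 1"]
        by (auto simp: 1 inner_axis tensor_def mat_def)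
    next
      case 2
      show ?thesis
        using has_int_norm by (simp add: 2)
    qed
    moreover have "(\<lambda>x. (tensor x x, 1 - (norm x)\<^sup>2) \<bullet> b) \<in> borel_measurable \<nu>"
      unfolding tensor_def
      by (intro borel_\<nu> borel_measurable_continuous_onI continuous_intros)
    ultimately show "has_bochner_integral ?\<mu> (\<lambda>x. (tensor x x, 1 - (norm x)\<^sup>2) \<bullet> b) ((l *\<^sub>R (mat 1, s)) \<bullet> b)"
      using g_nonneg by (intro has_bochner_integral_density) auto
  qed
  then have "s_isotropic s ?\<mu>"
    unfolding s_isotropic_def using \<open>l \<noteq> 0\<close> by blast
  moreover have "emeasure ?\<mu> (space ?\<mu>) \<noteq> 0"
  proof
    assume "emeasure ?\<mu> (space ?\<mu>) = 0"
    then have "(\<integral>\<^sup>+x. ennreal (g x) \<partial>\<nu>) = 0"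
      by (simp add: emeasure_density cong: nn_integral_cong)
    then have "AE x in \<nu>. ennreal (g x) = 0"
      by (subst (asm) nn_integral_0_iff_AE) auto
    then have "AE x in \<nu>. g x = 0"
      by eventually_elim (use g_nonneg in \<open>simp add: antisym\<close>)
    with g_nonzero show False ..
  qed
  ultimately show "let g = min_density s h F p; \<mu> = density \<nu> (\<lambda>x. ennreal (g x)) in
      g \<in> borel_measurable \<nu> \<and> (AE x in \<nu>. 0 \<le> g x) \<and> emeasure \<mu> (space \<mu>) \<noteq> 0 \<and>
      centered \<mu> \<and> s_isotropic s \<mu>"
    unfolding Let_def g_def[symmetric] using g_meas g_nonneg by auto
qed

end
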